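(* Consider the bilinear game $\min_{x\in\mathbb{R}^{d/2}}\max_{y\in\mathbb{R}^{d/2}} x^{\top}Ay$, where $A$ is a $\frac d2\times\frac d2$ positive semi-definite, full-rank matrix, and the $\mathcal{O}(\gamma)$-HRDE of Lookahead with gradient descent (step size $\gamma$) as base optimizer, with parameters $(k,\alpha)$, on this game: for $z(t)=(x(t),y(t))$, $$\ddot z(t)=-\frac{2}{\gamma}\dot z(t)-\frac{2k\alpha}{\gamma}F(z(t))+\Big(\sum_{i=1}^{k-1}i\Big)\,2\alpha\,\mathcal{J}(z(t))F(z(t)),$$ where $F(z)=(Ay,-Ax)$ and $\mathcal{J}$ is the Jacobian of $F$. Convergence of this dynamic, as determined by the poles of the Laplace transform $X(s)$ of $x(t)$, requires $$\alpha<\frac{k-1}{k}.$$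
   Context: Lookahead with gradient descent as base optimizer: from the current iterate $z_n$, take $k\ge1$ steps of $z\mapsto z-\gamma F(z)$ with step size $\gamma\in(0,1]$ to obtain $\tilde z_{n+k}$, and set $z_{n+1}=z_n+\alpha(\tilde z_{n+k}-z_n)$ with averaging coefficient $\alpha\in[0,1]$. HRDE stands for high-resolution differential equation; the $\mathcal{O}(\gamma)$-HRDE displayed in the claim is the continuous-time model of this method that retains terms up to linear order in $\gamma$. The Laplace transform is $X(s)=\int_0^\infty x(t)e^{-st}\,dt$. Convergence is analyzed through the poles of $X(s)$: if the dominant pole (the one with largest real part) lies in the negative half-plane, then $x(t)\to0$ as $t\to\infty$. *)

theory Defs
  imports "HOL-Complex_Analysis.Complex_Analysis"
begin

definition pos_semidef :: "real^'n^'n \<Rightarrow> bool" where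
  "pos_semidef A \<longleftrightarrow> transpose A = A \<and> (\<forall>v. 0 \<le> v \<bullet> (A *v v))"

(* The game vector field (grad_x f, - grad_y f) of f(x, y) = x^T A y for symmetric A. *)
definition bilinear_field :: "real^'n^'n \<Rightarrow> (real^'n) \<times> (real^'n) \<Rightarrow> (real^'n) \<times> (real^'n)" where
  "bilinear_field A z = (A *v snd z, - (A *v fst z))"

(* The Jacobian of F at a point, as a linear map, is the Frechet derivative;
   v is the velocity of the trajectory z. *)
definition lookahead_gd_hrde ::
    "('a::euclidean_space \<Rightarrow> 'a) \<Rightarrow> real \<Rightarrow> nat \<Rightarrow> real \<Rightarrow> (real \<Rightarrow> 'a) \<Rightarrow> bool" where
  "lookahead_gd_hrde F \<gamma> k \<alpha> z \<longleftrightarrow>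
     (\<exists>v. \<forall>t\<ge>0.
        (z has_vector_derivative v t) (at t within {0..}) \<and>
        (v has_vector_derivative
           (- (2 / \<gamma>) *\<^sub>R v t - (2 * real k * \<alpha> / \<gamma>) *\<^sub>R F (z t)
            + ((\<Sum>i=1..k-1. real i) * 2 * \<alpha>) *\<^sub>R frechet_derivative F (at (z t)) (F (z t))))
          (at t within {0..}))"

definition has_laplace_transform_at ::
    "(real \<Rightarrow> real^'n) \<Rightarrow> complex^'n \<Rightarrow> complex \<Rightarrow> bool" where
  "has_laplace_transform_at x L s \<longleftrightarrow>
     ((\<lambda>t. \<chi> j. complex_of_real (x t $ j) * exp (- s * complex_of_real t)) has_integral L) {0..}"

(* The integral converges only on a right half-plane, to the right of all poles, so the
   poles of X(s) are those of its meromorphic continuation to the complex plane. *)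
definition laplace_transform_of :: "(real \<Rightarrow> real^'n) \<Rightarrow> (complex \<Rightarrow> complex^'n) \<Rightarrow> bool" where
  "laplace_transform_of x X \<longleftrightarrow>
     (\<forall>j. (\<lambda>s. X s $ j) meromorphic_on UNIV) \<and>
     (\<exists>\<sigma>. \<forall>s. Re s > \<sigma> \<longrightarrow> has_laplace_transform_at x (X s) s)"

(* Need not be unique: complex poles come in conjugate pairs. For vector-valued X, the library's
   is_pole says that the norm of X tends to infinity, i.e. that some component has a pole. *)
definition dominant_pole :: "(complex \<Rightarrow> complex^'n) \<Rightarrow> complex \<Rightarrow> bool" where
  "dominant_pole X p \<longleftrightarrow> is_pole X p \<and> (\<forall>q. is_pole X q \<longrightarrow> Re q \<le> Re p)"

(* The pole-free alternative covers trajectories with x = 0, such as the equilibrium. *)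
definition pole_convergent :: "(real \<Rightarrow> real^'n) \<Rightarrow> bool" where
  "pole_convergent x \<longleftrightarrow>
     (\<exists>X. laplace_transform_of x X \<and>
        ((\<nexists>p. is_pole X p) \<or> (\<exists>p. dominant_pole X p \<and> Re p < 0)))"

(* Convergence of the dynamic: for all initial positions and velocities. *)
definition lookahead_gd_hrde_convergent ::
    "((real^'n) \<times> (real^'n) \<Rightarrow> (real^'n) \<times> (real^'n)) \<Rightarrow> real \<Rightarrow> nat \<Rightarrow> real \<Rightarrow> bool" where
  "lookahead_gd_hrde_convergent F \<gamma> k \<alpha> \<longleftrightarrow>
     (\<forall>z. lookahead_gd_hrde F \<gamma> k \<alpha> z \<longrightarrow> pole_convergent (\<lambda>t. fst (z t)))"

end

theory Submission
  imports Defs "HOL-Real_Asymp.Real_Asymp"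
begin

text \<open>
  Restricted to an eigenline \<open>A u = l u\<close>, with \<open>w = a + \<i> b\<close> encoding the state
  \<open>(a u, b u)\<close>, the dynamic becomes the scalar complex equation
  \<open>w'' + (2/\<gamma>) w' + (k (k - 1) \<alpha> l\<^sup>2 - 2 \<i> k \<alpha> l / \<gamma>) w = 0\<close>.
  If \<open>k \<alpha> \<ge> k - 1\<close>, its characteristic polynomial has a root \<open>s\<close> with \<open>Re s \<ge> 0\<close>.
  The solution \<open>w = exp (s t)\<close> gives \<open>x(t) = Re (exp (s t)) u\<close>, and any meromorphic
  continuation of its Laplace transform has a pole at \<open>s\<close> by the identity theorem.
\<close>

section \<open>Linear algebra and root location\<close>

text \<open>Rayleigh quotient argument: \<open>u\<close> maximizes
  \<open>v \<bullet> (A *v v)\<close> on the unit sphere. The quadratic form \<open>B\<close> of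
  \<open>l I - A\<close> is then nonnegative and vanishes at \<open>u\<close>, so its gradient
  there, twice the residual \<open>r\<close>, must vanish.\<close>

lemma symmetric_matrix_has_eigenvector:
  fixes A :: "real^'n^'n"
  assumes sym: "transpose A = A"
  obtains u l where "u \<noteq> 0" "A *v u = l *\<^sub>R u"
proof -
  have adj: "x \<bullet> (A *v y) = (A *v x) \<bullet> y" for x y
    by (metis dot_lmul_matrix sym transpose_matrix_vector)
  have "continuous_on (sphere 0 1) (\<lambda>v. v \<bullet> (A *v v))"
    by (intro continuous_intros linear_continuous_on) auto
  moreover have "sphere (0::real^'n) 1 \<noteq> {}"
    by simp
  ultimately obtain u where u: "norm u = 1"
    and umax: "\<And>v. norm v = 1 \<Longrightarrow> v \<bullet> (A *v v) \<le> u \<bullet> (A *v u)"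
    using continuous_attains_sup[OF compact_sphere, of "0::real^'n" 1 "\<lambda>v. v \<bullet> (A *v v)"]
    by (auto simp: dist_norm)
  define l where "l = u \<bullet> (A *v u)"
  define B where "B w = l * (w \<bullet> w) - w \<bullet> (A *v w)" for w
  have B_nonneg: "B w \<ge> 0" for w
  proof (cases "w = 0")
    case False
    have "(w /\<^sub>R norm w) \<bullet> (A *v (w /\<^sub>R norm w)) \<le> l"
      unfolding l_def by (rule umax) (use False in simp)
    hence "(w \<bullet> (A *v w)) / (norm w)\<^sup>2 \<le> l"
      by (simp add: matrix_vector_mult_scaleR power2_eq_square field_simps)
    thus ?thesis
      using False by (simp add: B_def field_simps power2_norm_eq_inner)
  qed (simp add: B_def)
  define r where "r = l *\<^sub>R u - A *v u"
  have "r \<bullet> r = 0"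
  proof (rule ccontr)
    assume nz: "r \<bullet> r \<noteq> 0"
    have Bu: "B u = 0"
      using u by (simp add: B_def l_def norm_eq_1)
    have expand: "B (u + t *\<^sub>R r) = 2 * t * (r \<bullet> r) + t\<^sup>2 * B r" for t
    proof -
      have ru: "r \<bullet> (A *v u) = u \<bullet> (A *v r)"
        by (metis adj inner_commute)
      have "r \<bullet> r = r \<bullet> (l *\<^sub>R u - A *v u)"
        by (simp only: r_def)
      hence rr: "r \<bullet> r = l * (u \<bullet> r) - u \<bullet> (A *v r)"
        by (simp add: inner_diff_right inner_commute[of r u] ru)
      have "B (u + t *\<^sub>R r) = B u + 2 * t * (l * (u \<bullet> r) - u \<bullet> (A *v r)) + t\<^sup>2 * B r"
        by (simp add: B_def matrix_vector_right_distrib matrix_vector_mult_scaleR inner_add_left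
            inner_add_right inner_commute[of r u] ru power2_eq_square algebra_simps)
      thus ?thesis
        by (simp only: Bu rr add_0_left)
    qed
    \<comment> \<open>A step against the gradient, which makes the linear term of
      \<open>expand\<close> dominate the quadratic one. The \<open>+ 1\<close> keeps the denominator
      positive when \<open>B r = 0\<close>.\<close>
    define t where "t = - (r \<bullet> r) / (B r + 1)"
    have "B r + 1 > 0"
      using B_nonneg[of r] by simp
    hence "t \<noteq> 0" and rt: "r \<bullet> r = - t * (B r + 1)"
      using nz by (auto simp: t_def)
    have "B (u + t *\<^sub>R r) = - (t\<^sup>2 * (B r + 2))"
      unfolding expand rt by (simp add: power2_eq_square algebra_simps)
    moreover have "t\<^sup>2 * (B r + 2) > 0"
      using \<open>t \<noteq> 0\<close> \<open>B r + 1 > 0\<close> by simp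
    ultimately show False
      using B_nonneg[of "u + t *\<^sub>R r"] by simp
  qed
  hence "A *v u = l *\<^sub>R u"
    by (simp add: r_def)
  moreover have "u \<noteq> 0"
    using u by auto
  ultimately show ?thesis
    using that by blast
qed

text \<open>The bound is the exact stability threshold: a root on the imaginary axis
  forces \<open>d\<^sup>2 = p\<^sup>2 * c\<close>.\<close>
lemma quadratic_root_Re_nonneg:
  fixes p c d :: real
  assumes "p \<ge> 0" "p\<^sup>2 * c \<le> d\<^sup>2"
  obtains s where "Re s \<ge> 0" "s\<^sup>2 + of_real p * s + (of_real c - \<i> * of_real d) = 0"
proof -
  \<comment> \<open>\<open>D\<close> is the discriminant. The principal root \<open>csqrt D\<close>
    has nonnegative real part, so \<open>s\<close> is the root further to the right.\<close>
  define D where "D = Complex (p\<^sup>2 - 4 * c) (4 * d)"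
  define s where "s = (csqrt D - of_real p) / 2"
  \<comment> \<open>The two sides differ by \<open>16 * (d\<^sup>2 - p\<^sup>2 * c)\<close>, and the
    right one is the square of \<open>cmod D\<close>.\<close>
  have "(p\<^sup>2 + 4 * c)\<^sup>2 \<le> (p\<^sup>2 - 4 * c)\<^sup>2 + (4 * d)\<^sup>2"
    using assms(2) by (simp add: power2_eq_square algebra_simps)
  hence "p\<^sup>2 + 4 * c \<le> cmod D"
    by (simp add: D_def cmod_def real_le_rsqrt)
  hence "p\<^sup>2 \<le> (cmod D + Re D) / 2"
    by (simp add: D_def)
  hence "p \<le> Re (csqrt D)"
    by (simp add: real_le_rsqrt)
  hence "Re s \<ge> 0"
    by (simp add: s_def)
  moreover have "s\<^sup>2 + of_real p * s = ((csqrt D)\<^sup>2 - (of_real p)\<^sup>2) / 4"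
    by (simp add: s_def power2_eq_square field_simps)
  hence "s\<^sup>2 + of_real p * s + (of_real c - \<i> * of_real d) = 0"
    by (simp add: D_def complex_eq_iff Re_power2 Im_power2 del: csqrt.simps)
  ultimately show ?thesis
    using that by blast
qed

section \<open>Laplace transform of a real exponential mode\<close>

lemma has_integral_cexp_atLeast_0:
  fixes a :: complex
  assumes "Re a < 0"
  shows "((\<lambda>t. exp (a * of_real t)) has_integral (- 1 / a)) {0..}"
proof -
  have a: "a \<noteq> 0"
    using assms by auto
  \<comment> \<open>Truncations of the integrand, integrated by the fundamental theorem of calculus;
    dominated convergence with majorant \<open>exp (Re a * t)\<close> then gives the improper
    integral.\<close>
  define f where "f n t = (if t \<in> {0..real n} then exp (a * of_real t) else 0)" for n t
  define I where "I n = exp (a * of_real (real n)) / a - 1 / a" for n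
  have f: "(f n has_integral I n) {0..}" for n
  proof -
    have "((\<lambda>t. exp (a * of_real t)) has_integral
        (exp (a * of_real (real n)) / a - exp (a * of_real 0) / a)) {0..real n}"
    proof (rule fundamental_theorem_of_calculus)
      fix t
      have "((\<lambda>w. exp (a * w) / a) has_field_derivative exp (a * of_real t)) (at (of_real t))"
        using a by (auto intro!: derivative_eq_intros)
      thus "((\<lambda>t. exp (a * of_real t) / a) has_vector_derivative exp (a * of_real t))
          (at t within {0..real n})"
        by (rule has_vector_derivative_real_field)
    qed simp
    thus ?thesis
      unfolding f_def I_def by (subst has_integral_restrict) auto
  qed
  show ?thesis
  proof (rule has_integral_dominated_convergence[where f = f and y = I
        and h = "\<lambda>t. exp (- (- Re a) * t)"])
    show "(\<lambda>t. exp (- (- Re a) * t)) integrable_on {0..}"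
      by (rule integrable_on_exp_minus_to_infinity) (use assms in simp)
    show "\<forall>t\<in>{0..}. norm (f n t) \<le> exp (- (- Re a) * t)" for n
      by (simp add: f_def)
    show "\<forall>t\<in>{0..}. (\<lambda>n. f n t) \<longlonglongrightarrow> exp (a * of_real t)"
    proof
      fix t :: real assume "t \<in> {0..}"
      moreover have "eventually (\<lambda>n. real n \<ge> t) at_top"
        by real_asymp
      ultimately have "eventually (\<lambda>n. f n t = exp (a * of_real t)) at_top"
        by (auto simp: f_def elim!: eventually_mono)
      thus "(\<lambda>n. f n t) \<longlonglongrightarrow> exp (a * of_real t)"
        by (rule tendsto_eventually)
    qed
    have "(\<lambda>n. exp (Re a * real n)) \<longlonglongrightarrow> 0"
      using assms by real_asymp
    hence "(\<lambda>n. exp (a * of_real (real n))) \<longlonglongrightarrow> 0"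
      by (subst tendsto_norm_zero_iff[symmetric]) simp
    hence "I \<longlonglongrightarrow> 0 / a - 1 / a"
      unfolding I_def using a by (intro tendsto_intros) auto
    thus "I \<longlonglongrightarrow> - 1 / a"
      by simp
  qed (rule f)
qed

text \<open>The real part is the mean of the exponentials with rates \<open>s\<close> and
  \<open>cnj s\<close>; both decay after damping by \<open>z\<close>, since the two rates have the
  same real part.\<close>

lemma laplace_Re_exp:
  fixes s z :: complex
  assumes "Re s < Re z"
  shows "((\<lambda>t. of_real (Re (exp (s * of_real t))) * exp (- z * of_real t)) has_integral
           (1 / (z - s) + 1 / (z - cnj s)) / 2) {0..}"
proof -
  have "((\<lambda>t. (exp ((s - z) * of_real t) + exp ((cnj s - z) * of_real t)) / 2) has_integral
      ((- 1 / (s - z) + - 1 / (cnj s - z)) / 2)) {0..}"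
    using assms by (intro has_integral_divide has_integral_add has_integral_cexp_atLeast_0) auto
  moreover have "(exp ((s - z) * of_real t) + exp ((cnj s - z) * of_real t)) / 2
      = of_real (Re (exp (s * of_real t))) * exp (- z * of_real t)" for t
  proof -
    have e: "of_real (Re (exp (s * of_real t))) = (exp (s * of_real t) + exp (cnj s * of_real t)) / 2"
      using complex_add_cnj[of "exp (s * of_real t)"] by (simp add: exp_cnj)
    have "exp ((w - z) * of_real t) = exp (w * of_real t) * exp (- z * of_real t)" for w
      by (simp add: mult_exp_exp algebra_simps)
    thus ?thesis
      unfolding e by (simp add: ring_distribs)
  qed
  moreover have "(- 1 / (s - z) + - 1 / (cnj s - z)) / 2 = (1 / (z - s) + 1 / (z - cnj s)) / 2"
    by (metis minus_diff_eq minus_divide_divide)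
  ultimately show ?thesis
    by (simp only:)
qed

text \<open>For real \<open>s\<close> the two fractions merge into \<open>1 / (z - s)\<close>.
  Otherwise \<open>1 / (z - s)\<close> factors out, and the cofactor \<open>g\<close> is continuous
  at \<open>s\<close> with value 1/2.\<close>

lemma is_pole_laplace_Re_exp:
  "is_pole (\<lambda>z. (1 / (z - s) + 1 / (z - cnj s)) / 2) s"
proof (cases "Im s = 0")
  case True
  hence "cnj s = s"
    by (simp add: complex_eq_iff)
  moreover have "(w + w) / 2 = w" for w :: complex
    by simp
  ultimately show ?thesis
    using is_pole_inverse[of s] by (simp only:)
next
  case False
  hence ne: "s \<noteq> cnj s"
    by (simp add: complex_eq_iff)
  define g where "g z = (1 + (z - s) / (z - cnj s)) / 2" for z
  have "is_pole (\<lambda>z. g z / (z - s)) s"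
  proof (rule is_pole_divide)
    show "isCont g s"
      unfolding g_def using ne by (auto intro!: continuous_intros)
    show "filterlim (\<lambda>z. z - s) (at 0) (at s)"
      by (simp add: filterlim_at_withinI eventually_at_filter tendsto_eq_intros LIM_zero)
    show "g s \<noteq> 0"
      by (simp add: g_def)
  qed
  \<comment> \<open>The case \<open>b = 0\<close>, that is \<open>z = cnj s\<close>, holds because
    division by zero yields zero.\<close>
  moreover have "(1 + a / b) / 2 / a = (1 / a + 1 / b) / 2" if "a \<noteq> 0" for a b :: complex
    using that by (cases "b = 0") (simp_all add: field_simps)
  hence g: "g z / (z - s) = (1 / (z - s) + 1 / (z - cnj s)) / 2" if "z \<noteq> s" for z
    unfolding g_def using that by (metis right_minus_eq)
  have "eventually (\<lambda>z. z \<noteq> s) (at s)"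
    by (simp add: eventually_at_filter)
  hence "eventually (\<lambda>z. g z / (z - s) = (1 / (z - s) + 1 / (z - cnj s)) / 2) (at s)"
    by eventually_elim (rule g)
  ultimately show ?thesis
    by (rule is_pole_transform) simp
qed

section \<open>Poles of the meromorphic continuation\<close>

text \<open>Identity theorem: off a sparse set the difference is either identically zero or nowhere
  zero, and its zeros on \<open>S\<close> exclude the latter. Only a punctured neighbourhood of
  \<open>w\<close> is reached, as values at isolated points are arbitrary.\<close>

lemma meromorphic_eq_on_open_imp_eq_at:
  assumes "f meromorphic_on UNIV" "g meromorphic_on UNIV"
    and "open S" "S \<noteq> {}" "\<And>z. z \<in> S \<Longrightarrow> f z = g z"
  shows "eventually (\<lambda>z. f z = g z) (at w)"
proof -
  have "(\<lambda>z. f z - g z) meromorphic_on UNIV"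
    using assms by (intro meromorphic_intros)
  hence "eventually (\<lambda>z. f z - g z = 0) (cosparse UNIV)
      \<or> eventually (\<lambda>z. f z - g z \<noteq> 0) (cosparse UNIV)"
    by (rule meromorphic_imp_constant_or_avoid) auto
  moreover have "\<not> eventually (\<lambda>z. f z - g z \<noteq> 0) (cosparse UNIV)"
  proof
    assume ev: "eventually (\<lambda>z. f z - g z \<noteq> 0) (cosparse UNIV)"
    obtain x where x: "x \<in> S"
      using assms by auto
    have "eventually (\<lambda>z. f z - g z \<noteq> 0) (at x)"
      using ev by (simp add: eventually_cosparse_open_eq)
    moreover have "eventually (\<lambda>z. z \<in> S) (at x)"
      using assms x by (simp add: eventually_at_in_open')
    ultimately have "eventually (\<lambda>z. False) (at x)"
      by eventually_elim (use assms in auto)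
    thus False
      by simp
  qed
  ultimately show ?thesis
    by (auto simp: eventually_cosparse_open_eq)
qed

lemma is_pole_vec_nth:
  fixes X :: "complex \<Rightarrow> complex^'n"
  assumes "is_pole (\<lambda>z. X z $ j) s"
  shows "is_pole X s"
  using assms unfolding is_pole_def filterlim_at_infinity_conv_norm_at_top
  by (rule filterlim_at_top_mono) (simp add: Finite_Cartesian_Product.norm_nth_le)

text \<open>On a right half-plane a component of \<open>X\<close> with
  \<open>u $ j \<noteq> 0\<close> equals an explicit rational function. The identity theorem carries
  this equality left to \<open>s\<close>, where that function has a pole.\<close>

lemma is_pole_laplace_transform:
  fixes X :: "complex \<Rightarrow> complex^'n"
  assumes X: "laplace_transform_of (\<lambda>t. Re (exp (s * of_real t)) *\<^sub>R u) X" and "u \<noteq> 0"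
  shows "is_pole X s"
proof -
  obtain j where j: "u $ j \<noteq> 0"
    using \<open>u \<noteq> 0\<close> by (auto simp: vec_eq_iff)
  define f where "f z = of_real (u $ j) * ((1 / (z - s) + 1 / (z - cnj s)) / 2)" for z
  from X obtain \<sigma> where mero: "(\<lambda>z. X z $ j) meromorphic_on UNIV"
    and L: "\<And>z. Re z > \<sigma> \<Longrightarrow>
      has_laplace_transform_at (\<lambda>t. Re (exp (s * of_real t)) *\<^sub>R u) (X z) z"
    by (auto simp: laplace_transform_of_def)
  \<comment> \<open>To the right of \<open>M\<close> both the integral defining \<open>X\<close> and
    the explicit one converge.\<close>
  define M where "M = max \<sigma> (Re s)"
  have "X z $ j = f z" if "Re z > M" for z
  proof -
    have z: "Re z > \<sigma>" "Re z > Re s"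
      using that by (auto simp: M_def)
    have "((\<lambda>t. of_real (u $ j) * (of_real (Re (exp (s * of_real t))) * exp (- z * of_real t)))
        has_integral f z) {0..}"
      unfolding f_def using z by (intro has_integral_mult_right laplace_Re_exp) auto
    moreover have "((\<lambda>t. of_real (u $ j) *
        (of_real (Re (exp (s * of_real t))) * exp (- z * of_real t))) has_integral X z $ j) {0..}"
      using has_integral_linear[OF L[unfolded has_laplace_transform_at_def]
          bounded_linear_vec_nth[of j], of z] z
      by (simp add: o_def mult_ac)
    ultimately show ?thesis
      by (rule has_integral_unique[rotated])
  qed
  moreover have "f meromorphic_on UNIV"
    unfolding f_def by (intro meromorphic_intros)
  moreover have "of_real (M + 1) \<in> {z. Re z > M}"
    by simp
  ultimately have "eventually (\<lambda>z. X z $ j = f z) (at s)"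
    using mero open_halfspace_Re_gt[of M]
    by (intro meromorphic_eq_on_open_imp_eq_at[where S = "{z. Re z > M}"]) blast+
  moreover have "is_pole f s"
    unfolding f_def using j is_pole_laplace_Re_exp[of s] by (subst is_pole_cmult_iff) auto
  ultimately have "is_pole (\<lambda>z. X z $ j) s"
    using is_pole_cong by fast
  thus ?thesis
    by (rule is_pole_vec_nth)
qed

lemma not_pole_convergent_Re_exp:
  fixes u :: "real^'n"
  assumes "u \<noteq> 0" "Re s \<ge> 0"
  shows "\<not> pole_convergent (\<lambda>t. Re (exp (s * of_real t)) *\<^sub>R u)"
proof
  assume "pole_convergent (\<lambda>t. Re (exp (s * of_real t)) *\<^sub>R u)"
  then obtain X where X: "laplace_transform_of (\<lambda>t. Re (exp (s * of_real t)) *\<^sub>R u) X"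
    and poles: "(\<nexists>p. is_pole X p) \<or> (\<exists>p. dominant_pole X p \<and> Re p < 0)"
    unfolding pole_convergent_def by blast
  have "is_pole X s"
    using X assms(1) by (rule is_pole_laplace_transform)
  with poles assms(2) show False
    by (force simp: dominant_pole_def)
qed

section \<open>Eigenmodes of the dynamic and the stability bound\<close>

lemma linear_bilinear_field: "linear (bilinear_field A)"
  by (rule linearI)
    (auto simp: bilinear_field_def matrix_vector_right_distrib matrix_vector_mult_scaleR)

text \<open>Under the embedding \<open>P\<close> of the complex numbers, the field acts as
  multiplication by \<open>- \<i> * l\<close>. Being linear, it is its own Jacobian, so the Jacobian
  term applies it twice and contributes the factor \<open>- l\<^sup>2\<close>. What remains is the
  hypothesis on \<open>s\<close>.\<close>

lemma lookahead_gd_hrde_exp_eigenvector: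
  fixes A :: "real^'n^'n" and s :: complex
  assumes eig: "A *v u = l *\<^sub>R u"
    and s: "s\<^sup>2 + of_real (2 / \<gamma>) * s
      + (of_real ((\<Sum>i=1..k-1. real i) * 2 * \<alpha> * l\<^sup>2)
         - \<i> * of_real (2 * real k * \<alpha> / \<gamma> * l)) = 0"
  shows "lookahead_gd_hrde (bilinear_field A) \<gamma> k \<alpha>
    (\<lambda>t. (Re (exp (s * of_real t)) *\<^sub>R u, Im (exp (s * of_real t)) *\<^sub>R u))"
proof -
  define P where "P w = (Re w *\<^sub>R u, Im w *\<^sub>R u)" for w
  have P: "bounded_linear P"
    unfolding P_def
    by (intro bounded_linear_Pair bounded_linear_compose[OF bounded_linear_scaleR_left]
        bounded_linear_Re bounded_linear_Im)
  have F: "bilinear_field A (P w) = P (- \<i> * of_real l * w)" for w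
    by (simp add: bilinear_field_def P_def matrix_vector_mult_scaleR eig mult_ac)
  have J: "frechet_derivative (bilinear_field A) (at x) = bilinear_field A" for x
    using linear_bilinear_field[of A]
    by (metis frechet_derivative_at linear_imp_has_derivative)
  have deriv: "((\<lambda>t. P (c * exp (s * of_real t))) has_vector_derivative P (c * (s * exp (s * of_real t))))
      (at t within T)" for c t T
  proof (rule bounded_linear.has_vector_derivative[OF P])
    have "((\<lambda>w. c * exp (s * w)) has_field_derivative c * (s * exp (s * of_real t))) (at (of_real t))"
      by (auto intro!: derivative_eq_intros)
    thus "((\<lambda>t. c * exp (s * of_real t)) has_vector_derivative c * (s * exp (s * of_real t)))
        (at t within T)"
      by (rule has_vector_derivative_real_field)
  qed
  define S where "S = (\<Sum>i=1..k-1. real i) * 2 * \<alpha>"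
  have rhs: "P (s * (s * w)) = - (2 / \<gamma>) *\<^sub>R P (s * w)
      - (2 * real k * \<alpha> / \<gamma>) *\<^sub>R bilinear_field A (P w)
      + S *\<^sub>R bilinear_field A (bilinear_field A (P w))" for w
  proof -
    have "s * (s * w) = s\<^sup>2 * w"
      by (simp add: power2_eq_square)
    also have "s\<^sup>2 = - of_real (2 / \<gamma>) * s - of_real (S * l\<^sup>2)
        + \<i> * of_real (2 * real k * \<alpha> / \<gamma> * l)"
      using s unfolding S_def[symmetric] by (simp add: algebra_simps add_eq_0_iff)
    \<comment> \<open>Coefficients are regrouped so that each factor \<open>- \<i> * l\<close> can
      be read back through \<open>F\<close> as one application of the field.\<close>
    also have "\<dots> * w = - (2 / \<gamma>) *\<^sub>R (s * w)
        - (2 * real k * \<alpha> / \<gamma>) *\<^sub>R (- \<i> * of_real l * w)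
        + S *\<^sub>R (- \<i> * of_real l * (- \<i> * of_real l * w))"
      by (simp add: scaleR_conv_of_real power2_eq_square algebra_simps)
    finally have e: "s * (s * w) = \<dots>" .
    interpret P: bounded_linear P
      by (rule P)
    show ?thesis
      unfolding F e P.add P.diff P.scaleR by (rule refl)
  qed
  show ?thesis
    unfolding lookahead_gd_hrde_def J P_def[symmetric] S_def[symmetric]
  proof (intro exI[of _ "\<lambda>t. P (s * exp (s * of_real t))"] allI impI conjI)
    fix t :: real
    show "((\<lambda>t. P (exp (s * of_real t))) has_vector_derivative P (s * exp (s * of_real t)))
        (at t within {0..})"
      using deriv[of 1] by simp
    show "((\<lambda>t. P (s * exp (s * of_real t))) has_vector_derivative
        - (2 / \<gamma>) *\<^sub>R P (s * exp (s * of_real t))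
        - (2 * real k * \<alpha> / \<gamma>) *\<^sub>R bilinear_field A (P (exp (s * of_real t)))
        + S *\<^sub>R bilinear_field A (bilinear_field A (P (exp (s * of_real t))))) (at t within {0..})"
      using deriv[of s] by (simp only: rhs)
  qed
qed

theorem mainTheorem2:
  fixes A :: "real^'n^'n" and \<gamma> \<alpha> :: real and k :: nat
  assumes "pos_semidef A" and "rank A = CARD('n)"
    and "0 < \<gamma>" and "\<gamma> \<le> 1"
    and "0 \<le> \<alpha>" and "\<alpha> \<le> 1"
    and "k \<ge> 1"
    and "lookahead_gd_hrde_convergent (bilinear_field A) \<gamma> k \<alpha>"
  shows "\<alpha> < (real k - 1) / real k"
proof (rule ccontr)
  assume "\<not> \<alpha> < (real k - 1) / real k"
  hence \<alpha>: "real k - 1 \<le> real k * \<alpha>"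
    using \<open>k \<ge> 1\<close> by (simp add: field_simps)
  obtain u l where u: "u \<noteq> 0" "A *v u = l *\<^sub>R u"
    using symmetric_matrix_has_eigenvector \<open>pos_semidef A\<close> by (metis pos_semidef_def)
  \<comment> \<open>Gauss sum; for \<open>k = 1\<close> the range is empty and both sides are
    0.\<close>
  have sum: "(\<Sum>i=1..k-1. real i) * 2 = real k * (real k - 1)"
    using \<open>k \<ge> 1\<close> double_gauss_sum_from_Suc_0[of "k - 1", where ?'a = real]
    by (simp add: of_nat_diff mult_ac)
  \<comment> \<open>Scaled by \<open>(2 / \<gamma>)\<^sup>2 * l\<^sup>2\<close>, this becomes the
    root criterion \<open>p\<^sup>2 * c \<le> d\<^sup>2\<close> with
    \<open>p = 2 / \<gamma>\<close>, \<open>c = k * (k - 1) * \<alpha> * l\<^sup>2\<close> and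
    \<open>d = 2 * k * \<alpha> / \<gamma> * l\<close>.\<close>
  have "(real k * \<alpha>) * (real k - 1) \<le> (real k * \<alpha>) * (real k * \<alpha>)"
    using \<alpha> \<open>0 \<le> \<alpha>\<close> by (intro mult_left_mono) auto
  hence "(2 / \<gamma>)\<^sup>2 * l\<^sup>2 * ((real k * \<alpha>) * (real k - 1))
      \<le> (2 / \<gamma>)\<^sup>2 * l\<^sup>2 * ((real k * \<alpha>) * (real k * \<alpha>))"
    by (rule mult_left_mono) simp
  hence "(2 / \<gamma>)\<^sup>2 * ((\<Sum>i=1..k-1. real i) * 2 * \<alpha> * l\<^sup>2) \<le> (2 * real k * \<alpha> / \<gamma> * l)\<^sup>2"
    unfolding sum by (simp add: power2_eq_square mult_ac)
  moreover have "0 \<le> 2 / \<gamma>"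
    using \<open>0 < \<gamma>\<close> by simp
  ultimately obtain s where "Re s \<ge> 0" and s: "s\<^sup>2 + of_real (2 / \<gamma>) * s
      + (of_real ((\<Sum>i=1..k-1. real i) * 2 * \<alpha> * l\<^sup>2)
         - \<i> * of_real (2 * real k * \<alpha> / \<gamma> * l)) = 0"
    using quadratic_root_Re_nonneg by blast
  have "pole_convergent (\<lambda>t. Re (exp (s * of_real t)) *\<^sub>R u)"
    using lookahead_gd_hrde_exp_eigenvector[OF u(2) s]
      \<open>lookahead_gd_hrde_convergent (bilinear_field A) \<gamma> k \<alpha>\<close>
    unfolding lookahead_gd_hrde_convergent_def by fastforce
  thus False
    using not_pole_convergent_Re_exp u(1) \<open>Re s \<ge> 0\<close> by blast
qed

end
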